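(* Let $\omega = \tfrac12 + \tfrac{\sqrt{-7}}{2}$ and $\mathcal{E}_{-7} = \{ n \in \mathbb{Z}[\omega] : |n|^2 \le 2\}$. For every $n \in \mathbb{Z}[\omega] \setminus \mathcal{E}_{-7}$ there exist nonzero $a,b,c \in \mathbb{Z}[\omega]$ with $\frac{4}{n} = \frac1a + \frac1b + \frac1c$.
   Context: $\mathbb{Z}[\omega]$ is the ring of integers of $\mathbb{Q}(\sqrt{-7})$; for $n = x + y\omega$ with $x,y\in\mathbb{Z}$, $|n|^2 = x^2 + xy + 2y^2$. *)

theory Defs
  imports Complex_Main
begin

definition omega :: complex where
  "omega = 1 / 2 + csqrt (- 7) / 2"

definition Z_omega :: "complex set" where
  "Z_omega = {of_int x + of_int y * omega | x y :: int. True}"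

definition E_minus7 :: "complex set" where
  "E_minus7 = {n \<in> Z_omega. (cmod n)\<^sup>2 \<le> 2}"

lemma omega_altdef: "omega = Complex (1 / 2) (sqrt 7 / 2)"
  by (simp add: omega_def csqrt_of_real_nonpos complex_eq_iff)

lemma norm_Z_omega:
  "(cmod (of_int x + of_int y * omega))\<^sup>2 = of_int (x\<^sup>2 + x * y + 2 * y\<^sup>2)"
  by (simp add: omega_altdef cmod_power2 power_mult_distrib power_divide)
     (simp add: power2_eq_square algebra_simps)

lemma omega_square: "omega\<^sup>2 = omega - 2"
  by (simp add: omega_altdef complex_eq_iff power2_eq_square)

lemma Z_omega_mult: "a \<in> Z_omega \<Longrightarrow> b \<in> Z_omega \<Longrightarrow> a * b \<in> Z_omega"
proof -
  assume "a \<in> Z_omega" "b \<in> Z_omega"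
  then obtain x y u v :: int
    where a: "a = of_int x + of_int y * omega" and b: "b = of_int u + of_int v * omega"
    by (auto simp: Z_omega_def)
  have "a * b = of_int x * of_int u + (of_int x * of_int v + of_int y * of_int u) * omega
                + of_int y * of_int v * omega\<^sup>2"
    by (simp add: a b power2_eq_square algebra_simps)
  also have "\<dots> = of_int (x * u - 2 * y * v) + of_int (x * v + y * u + y * v) * omega"
    by (simp add: omega_square algebra_simps)
  finally show ?thesis
    unfolding Z_omega_def by blast
qed

end

theory Submission
  imports Defs
begin

text \<open>
  In \<open>\<int>[\<omega>]\<close> the prime 2 splits as \<open>\<omega> (1 - \<omega>)\<close>. Solutions pass to multiples, so even \<open>n\<close> reduce
  to odd ones and to \<open>\<omega>\<^sup>2\<close>, \<open>2\<close>, \<open>(1 - \<omega>)\<^sup>2\<close>. An odd \<open>n\<close> is congruent mod 4 to \<open>\<plusminus>1\<close>, in which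
  case two unit fractions suffice, or to \<open>\<plusminus>\<surd>-7\<close>. In the last case write \<open>n + t = 4 a\<close> with \<open>t\<close>
  fixed. If \<open>d\<close> and \<open>e\<close> divide \<open>a\<close> and \<open>d + n e = t m\<close>, then
  \<open>4/n - 1/a = t/(n a) = 1/(n m (a/d)) + 1/(m (a/e))\<close>. After a change of sign of \<open>n\<close>, taking
  \<open>t = \<surd>-7\<close> (norm 7) works as soon as \<open>a\<close> is divisible by \<open>\<omega>\<close> or \<open>1 - \<omega>\<close>, because \<open>\<plusminus>1, \<plusminus>\<omega>, \<plusminus>1/\<omega>\<close>
  are all the units modulo \<open>t\<close>. Otherwise both \<open>t = 2\<omega> + 3\<close> and \<open>t = 2\<omega> - 5\<close> (norm 23) make \<open>a\<close>
  even, and the two values of \<open>a/2\<close> differ by 1, so that one of them makes \<open>a\<close> divisible by \<open>2\<omega>\<close>;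
  the signed quotients of divisors of \<open>2\<omega>\<close> represent every unit modulo \<open>t\<close>. If \<open>t\<close> itself divides \<open>n\<close>,
  an explicit decomposition of \<open>4/t\<close> is used instead.
\<close>

section \<open>The three-term equation and arithmetic in Z[omega]\<close>

definition solvable :: "complex \<Rightarrow> bool" where
  "solvable n \<longleftrightarrow> (\<exists>a \<in> Z_omega. \<exists>b \<in> Z_omega. \<exists>c \<in> Z_omega.
     a \<noteq> 0 \<and> b \<noteq> 0 \<and> c \<noteq> 0 \<and> 4 / n = 1 / a + 1 / b + 1 / c)"

lemma solvableI:
  assumes "a \<in> Z_omega" "b \<in> Z_omega" "c \<in> Z_omega" "a \<noteq> 0" "b \<noteq> 0" "c \<noteq> 0"
    and "4 / n = 1 / a + 1 / b + 1 / c"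
  shows "solvable n"
  using assms unfolding solvable_def by blast

lemma Z_omegaI: "of_int x + of_int y * omega \<in> Z_omega"
  unfolding Z_omega_def by blast

lemma Z_omega_of_int [simp]: "of_int x \<in> Z_omega"
  using Z_omegaI[of x 0] by simp

lemma Z_omega_omega [simp]: "omega \<in> Z_omega"
  using Z_omegaI[of 0 1] by simp

lemma Z_omega_one [simp]: "1 \<in> Z_omega"
  using Z_omega_of_int[of 1] by simp

lemma Z_omega_numeral [simp]: "numeral k \<in> Z_omega"
  using Z_omega_of_int[of "numeral k"] by simp

lemma Z_omega_add [simp]:
  assumes "a \<in> Z_omega" "b \<in> Z_omega"
  shows "a + b \<in> Z_omega"
proof -
  obtain x y u v :: int
    where "a = of_int x + of_int y * omega" "b = of_int u + of_int v * omega"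
    using assms by (auto simp: Z_omega_def)
  then have "a + b = of_int (x + u) + of_int (y + v) * omega"
    by (simp add: algebra_simps)
  then show ?thesis
    unfolding Z_omega_def by blast
qed

declare Z_omega_mult [simp]

lemma Z_omega_uminus [simp]: "a \<in> Z_omega \<Longrightarrow> - a \<in> Z_omega"
  using Z_omega_mult[OF Z_omega_of_int[of "- 1"], of a] by simp

lemma Z_omega_diff [simp]: "a \<in> Z_omega \<Longrightarrow> b \<in> Z_omega \<Longrightarrow> a - b \<in> Z_omega"
  using Z_omega_add[of a "- b"] by simp

lemma Z_omega_power [simp]: "a \<in> Z_omega \<Longrightarrow> a ^ k \<in> Z_omega"
  by (induction k) auto

lemma omega_mult_omega: "omega * omega = omega - 2"
  using omega_square by (simp add: power2_eq_square)

lemma omega_mult_omega_left: "omega * (omega * z) = (omega - 2) * z"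
  using omega_mult_omega by (metis mult.assoc)

lemmas omega_simps = algebra_simps omega_mult_omega omega_mult_omega_left

lemma norm_omega: "(cmod omega)\<^sup>2 = 2"
  using norm_Z_omega[of 0 1] by simp

lemma norm_one_minus_omega: "(cmod (1 - omega))\<^sup>2 = 2"
  using norm_Z_omega[of 1 "- 1"] by simp

lemma omega_neq_0: "omega \<noteq> 0" "1 - omega \<noteq> 0"
  using norm_omega norm_one_minus_omega by auto

lemma solvable_mult:
  assumes "solvable n" "k \<in> Z_omega" "k \<noteq> 0"
  shows "solvable (n * k)"
proof -
  obtain a b c where abc: "a \<in> Z_omega" "b \<in> Z_omega" "c \<in> Z_omega" "a \<noteq> 0" "b \<noteq> 0" "c \<noteq> 0"
    and eq: "4 / n = 1 / a + 1 / b + 1 / c"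
    using assms(1) unfolding solvable_def by blast
  have "4 / (n * k) = 4 / n / k"
    by simp
  also have "\<dots> = 1 / (a * k) + 1 / (b * k) + 1 / (c * k)"
    by (simp add: eq add_divide_distrib)
  finally show ?thesis
    using abc assms by (intro solvableI[of "a * k" "b * k" "c * k"]) auto
qed

lemma solvable_uminus: "solvable (- n) \<Longrightarrow> solvable n"
  using solvable_mult[of "- n" "- 1"] by simp

section \<open>Residues modulo \<open>t\<close>\<close>

text \<open>For \<open>t\<close> of prime norm p the quotient of Z[omega] by \<open>t\<close> is the
  field with p elements, so rational integers represent all classes and arithmetic modulo
  \<open>t\<close> becomes arithmetic modulo p.\<close>

definition has_residue :: "complex \<Rightarrow> complex \<Rightarrow> int \<Rightarrow> bool" where
  "has_residue t z r \<longleftrightarrow> (\<exists>w \<in> Z_omega. z - of_int r = t * w)"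

lemma has_residueI: "w \<in> Z_omega \<Longrightarrow> z - of_int r = t * w \<Longrightarrow> has_residue t z r"
  unfolding has_residue_def by blast

lemma has_residue_of_int: "has_residue t (of_int r) r"
  using has_residueI[OF Z_omega_of_int[of 0]] by simp

lemma has_residue_add:
  assumes "has_residue t z r" "has_residue t z' r'"
  shows "has_residue t (z + z') (r + r')"
proof -
  obtain w w' where "w \<in> Z_omega" "w' \<in> Z_omega" "z - of_int r = t * w" "z' - of_int r' = t * w'"
    using assms unfolding has_residue_def by blast
  then show ?thesis
    by (intro has_residueI[of "w + w'"]) (auto simp: algebra_simps)
qed

lemma has_residue_mult:
  assumes "has_residue t z r" "has_residue t z' r'" "z \<in> Z_omega"
  shows "has_residue t (z * z') (r * r')"
proof -
  obtain w w' where w: "w \<in> Z_omega" "w' \<in> Z_omega"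
    and eq: "z - of_int r = t * w" "z' - of_int r' = t * w'"
    using assms unfolding has_residue_def by blast
  have "z * z' - of_int (r * r') = z * (z' - of_int r') + of_int r' * (z - of_int r)"
    by (simp add: algebra_simps)
  also have "\<dots> = t * (z * w' + of_int r' * w)"
    unfolding eq by (simp add: algebra_simps)
  finally show ?thesis
    by (rule has_residueI[rotated]) (use w assms in auto)
qed

lemma has_residue_power:
  assumes "has_residue t z r" "z \<in> Z_omega"
  shows "has_residue t (z ^ k) (r ^ k)"
proof (induction k)
  case 0
  then show ?case using has_residue_of_int[of t 1] by simp
next
  case (Suc k)
  then show ?case using has_residue_mult[OF assms(1) _ assms(2)] by simp
qed

text \<open>Turns divisibility by \<open>p\<close> in the integers into divisibility by
  \<open>t\<close>: residue 0 of \<open>p\<close> means that \<open>t\<close> divides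
  \<open>p\<close>.\<close>

lemma has_residue_dvd:
  assumes "has_residue t z r" "has_residue t (of_int p) 0" "p dvd r"
  obtains w where "w \<in> Z_omega" "z = t * w"
proof -
  obtain k where k: "r = p * k"
    using assms(3) by blast
  obtain w w' where w: "w \<in> Z_omega" "w' \<in> Z_omega" "z - of_int r = t * w" "of_int p = t * w'"
    using assms unfolding has_residue_def by auto
  have "z = t * w + of_int p * of_int k"
    using w(3) by (simp add: k algebra_simps)
  then have "z = t * (w + w' * of_int k)"
    unfolding w(4) by (simp add: algebra_simps)
  then show ?thesis
    by (rule that[rotated]) (use w in auto)
qed

section \<open>Splitting the remainder by divisors of \<open>a\<close>\<close>

lemma solvable_of_divisors:
  assumes "n \<in> Z_omega" "n \<noteq> 0" "a \<noteq> 0" "4 * a = n + t"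
    and "a = d * p" "a = e * q" "p \<in> Z_omega" "q \<in> Z_omega" "d \<in> Z_omega"
    and "d + n * e = t * m" "m \<in> Z_omega" "d + n * e \<noteq> 0"
  shows "solvable n"
proof (rule solvableI)
  have nz: "d \<noteq> 0" "p \<noteq> 0" "e \<noteq> 0" "q \<noteq> 0" "m \<noteq> 0" "t \<noteq> 0"
    using assms by auto
  show "a \<in> Z_omega" "n * m * p \<in> Z_omega" "m * q \<in> Z_omega"
    using assms by auto
  show "a \<noteq> 0" "n * m * p \<noteq> 0" "m * q \<noteq> 0"
    using assms nz by auto
  \<comment> \<open>Over the common denominator \<open>n * m * a\<close> the numerators add up to
    \<open>d + n * e = t * m\<close>, so \<open>m\<close> cancels.\<close>
  have "1 / (n * m * p) = d / (n * m * a)" "1 / (m * q) = n * e / (n * m * a)"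
    using assms(2,5) nz by simp (use assms(2,6) nz in simp)
  then have "1 / (n * m * p) + 1 / (m * q) = t * m / (n * m * a)"
    unfolding assms(10)[symmetric] by (simp add: add_divide_distrib)
  also have "\<dots> = (4 * a - n) / (n * a)"
    using nz assms(4) by simp
  also have "\<dots> = 4 / n - 1 / a"
    using assms(2,3) by (simp add: field_simps)
  finally show "4 / n = 1 / a + 1 / (n * m * p) + 1 / (m * q)"
    by (metis add.assoc add.commute diff_add_cancel)
qed

text \<open>
  Here \<open>\<rho>\<close> and \<open>1 - \<rho>\<close> are the residues of the two primes above 2 modulo an element of norm \<open>p\<close>.
\<close>

lemma units_of_table:
  fixes p \<rho> :: int
  assumes "p > 0"
    and "\<forall>r\<in>{1..p - 1}. \<exists>s\<in>{1, -1}. \<exists>i\<in>{..I}. \<exists>j\<in>{..J}. \<exists>k\<in>{..I}. \<exists>l\<in>{..J}.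
       p dvd s * \<rho> ^ i * (1 - \<rho>) ^ j + r * (\<rho> ^ k * (1 - \<rho>) ^ l)"
    and "\<not> p dvd r"
  shows "\<exists>s\<in>{1, -1}. \<exists>i\<le>I. \<exists>j\<le>J. \<exists>k\<le>I. \<exists>l\<le>J.
       p dvd s * \<rho> ^ i * (1 - \<rho>) ^ j + r * (\<rho> ^ k * (1 - \<rho>) ^ l)"
proof -
  have "r mod p \<noteq> 0"
    using assms(3) by (simp add: dvd_eq_mod_eq_0)
  moreover have "0 \<le> r mod p" "r mod p < p"
    using assms(1) by simp_all
  ultimately have "r mod p \<in> {1..p - 1}"
    by simp
  note table = assms(2)[THEN bspec, OF this]
  have "p dvd b + (r mod p) * c \<longleftrightarrow> p dvd b + r * c" for b c
  proof -
    have "(b + (r mod p) * c) mod p = (b + r * c) mod p"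
      by (intro mod_add_cong mod_mult_cong) simp_all
    then show ?thesis
      by (simp only: dvd_eq_mod_eq_0)
  qed
  with table show ?thesis
    by (simp only: Bex_def atMost_iff)
qed

lemma atMost_0_1_2: "{..0 :: nat} = {0}" "{..1 :: nat} = {0, 1}" "{..2 :: nat} = {0, 1, 2}"
  by auto

text \<open>Modulo \<open>2 * omega - 1\<close> the residue of \<open>omega\<close> is 4, and 1 - 4
  is again 4 modulo 7. The exponent bounds select the divisors of \<open>omega\<close> and of
  \<open>1 - omega\<close> respectively.\<close>

lemma units_7:
  "\<forall>r\<in>{1..7 - 1 :: int}. \<exists>s\<in>{1, -1}. \<exists>i\<in>{..1 :: nat}. \<exists>j\<in>{..0 :: nat}. \<exists>k\<in>{..1 :: nat}. \<exists>l\<in>{..0 :: nat}.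
     7 dvd s * 4 ^ i * (1 - 4) ^ j + r * (4 ^ k * (1 - 4) ^ l)"
  "\<forall>r\<in>{1..7 - 1 :: int}. \<exists>s\<in>{1, -1}. \<exists>i\<in>{..0 :: nat}. \<exists>j\<in>{..1 :: nat}. \<exists>k\<in>{..0 :: nat}. \<exists>l\<in>{..1 :: nat}.
     7 dvd s * 4 ^ i * (1 - 4) ^ j + r * (4 ^ k * (1 - 4) ^ l)"
  unfolding atMost_0_1_2 by (simp_all add: simp_from_to)

text \<open>The residues 10 and 14 of \<open>omega\<close> modulo \<open>2 * omega + 3\<close> and
  \<open>2 * omega - 5\<close> are the roots of X^2 - X + 2 modulo 23. The bounds 2 and 1 fit
  \<open>omega ^ 2 * (1 - omega) = 2 * omega\<close>.\<close>

lemma units_23: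
  "\<forall>r\<in>{1..23 - 1 :: int}. \<exists>s\<in>{1, -1}. \<exists>i\<in>{..2 :: nat}. \<exists>j\<in>{..1 :: nat}. \<exists>k\<in>{..2 :: nat}. \<exists>l\<in>{..1 :: nat}.
     23 dvd s * 10 ^ i * (1 - 10) ^ j + r * (10 ^ k * (1 - 10) ^ l)"
  "\<forall>r\<in>{1..23 - 1 :: int}. \<exists>s\<in>{1, -1}. \<exists>i\<in>{..2 :: nat}. \<exists>j\<in>{..1 :: nat}. \<exists>k\<in>{..2 :: nat}. \<exists>l\<in>{..1 :: nat}.
     23 dvd s * 14 ^ i * (1 - 14) ^ j + r * (14 ^ k * (1 - 14) ^ l)"
  unfolding atMost_0_1_2 by (simp_all add: simp_from_to)

lemma norm_omega_powers: "(cmod (omega ^ i * (1 - omega) ^ j))\<^sup>2 = 2 ^ (i + j)"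
proof -
  have "(cmod (omega ^ i * (1 - omega) ^ j))\<^sup>2 = ((cmod omega)\<^sup>2) ^ i * ((cmod (1 - omega))\<^sup>2) ^ j"
    by (simp add: norm_mult norm_power power2_eq_square power_mult_distrib mult_ac)
  then show ?thesis
    by (simp add: norm_omega norm_one_minus_omega power_add)
qed

text \<open>Common core for all choices of \<open>t\<close>. If \<open>t\<close> divides
  \<open>n\<close>, the solution for \<open>t\<close> is scaled; otherwise the table supplies
  divisors \<open>d\<close> and \<open>e\<close> of \<open>a\<close> for which \<open>t\<close>
  divides \<open>d + n * e\<close>.\<close>

lemma solvable_of_residue:
  fixes x y \<rho> p :: int and I J :: nat
  defines "n \<equiv> of_int x + of_int y * omega"
  assumes odd: "odd x" "even y" and large: "(cmod n)\<^sup>2 > 2"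
    and t: "solvable t" "has_residue t omega \<rho>" "has_residue t (of_int p) 0"
    and g: "g \<in> Z_omega" and a: "4 * (omega ^ I * (1 - omega) ^ J * g) = n + t"
    and p: "p > 0"
    and units: "\<forall>r\<in>{1..p - 1}. \<exists>s\<in>{1, -1}. \<exists>i\<in>{..I}. \<exists>j\<in>{..J}. \<exists>k\<in>{..I}. \<exists>l\<in>{..J}.
       p dvd s * \<rho> ^ i * (1 - \<rho>) ^ j + r * (\<rho> ^ k * (1 - \<rho>) ^ l)"
  shows "solvable n"
proof -
  have nZ: "n \<in> Z_omega"
    unfolding n_def by (rule Z_omegaI)
  have n0: "n \<noteq> 0"
    using large by auto
  have res_conj: "has_residue t (1 - omega) (1 - \<rho>)"
    using has_residue_add[OF has_residue_of_int[of t 1]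
        has_residue_mult[OF has_residue_of_int[of t "- 1"] t(2)]] by simp
  have res_n: "has_residue t n (x + y * \<rho>)"
    unfolding n_def
    by (intro has_residue_add has_residue_mult has_residue_of_int t(2) Z_omega_of_int)
  show ?thesis
  proof (cases "g = 0 \<or> p dvd x + y * \<rho>")
    case True
    then obtain w where "w \<in> Z_omega" "n = t * w"
    proof
      \<comment> \<open>Here \<open>a\<close> would vanish and could not be a denominator, but then
        \<open>n = - t\<close>.\<close>
      assume "g = 0"
      then have "n = t * (- 1)"
        using a by (simp add: eq_neg_iff_add_eq_0)
      then show ?thesis
        using that[of "- 1"] by simp
    next
      assume "p dvd x + y * \<rho>"
      then show ?thesis
        using has_residue_dvd[OF res_n t(3)] that by blast
    qed
    then show ?thesis
      using solvable_mult[OF t(1)] n0 by auto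
  next
    case False
    then have "\<not> p dvd x + y * \<rho>"
      by simp
    from units_of_table[OF p units this]
    obtain s i j k l where s: "s \<in> {1, -1}" and le: "i \<le> I" "j \<le> J" "k \<le> I" "l \<le> J"
      and dvd: "p dvd s * \<rho> ^ i * (1 - \<rho>) ^ j + (x + y * \<rho>) * (\<rho> ^ k * (1 - \<rho>) ^ l)"
      by blast
    define d where "d = of_int s * omega ^ i * (1 - omega) ^ j"
    define e where "e = omega ^ k * (1 - omega) ^ l"
    define a' where "a' = omega ^ I * (1 - omega) ^ J * g"
    have "has_residue t (d + n * e)
        (s * \<rho> ^ i * (1 - \<rho>) ^ j + (x + y * \<rho>) * (\<rho> ^ k * (1 - \<rho>) ^ l))"
      unfolding d_def e_def
      by (intro has_residue_add has_residue_mult has_residue_power has_residue_of_int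
          res_n res_conj t(2)) (use nZ in auto)
    then obtain m where m: "m \<in> Z_omega" "d + n * e = t * m"
      using has_residue_dvd t(3) dvd by blast
    have pow: "omega ^ I = omega ^ i * omega ^ (I - i)" "omega ^ I = omega ^ k * omega ^ (I - k)"
      "(1 - omega) ^ J = (1 - omega) ^ j * (1 - omega) ^ (J - j)"
      "(1 - omega) ^ J = (1 - omega) ^ l * (1 - omega) ^ (J - l)"
      using le by (simp_all flip: power_add)
    have s2: "of_int s * of_int s = (1 :: complex)"
      using s by auto
    have "a' = (of_int s * of_int s) * a'"
      by (simp add: s2)
    also have "\<dots> = d * (of_int s * omega ^ (I - i) * (1 - omega) ^ (J - j) * g)"
      unfolding a'_def d_def pow(1,3) by (simp only: mult_ac)
    finally have ad: "a' = d * (of_int s * omega ^ (I - i) * (1 - omega) ^ (J - j) * g)" .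
    have ae: "a' = e * (omega ^ (I - k) * (1 - omega) ^ (J - l) * g)"
      unfolding a'_def e_def pow(2,4) by (simp only: mult_ac)
    \<comment> \<open>Otherwise comparing norms makes \<open>N\<close>, the norm of
      \<open>n\<close>, a divisor of a power of 2; but \<open>N\<close> is odd and exceeds
      2.\<close>
    have "d + n * e \<noteq> 0"
    proof
      assume "d + n * e = 0"
      then have "(cmod d)\<^sup>2 = (cmod (n * e))\<^sup>2"
        by (metis add_eq_0_iff norm_minus_cancel)
      moreover have "(cmod d)\<^sup>2 = (cmod (omega ^ i * (1 - omega) ^ j))\<^sup>2"
        using s by (auto simp: d_def norm_mult)
      moreover have "(cmod (n * e))\<^sup>2 = (cmod n)\<^sup>2 * (cmod (omega ^ k * (1 - omega) ^ l))\<^sup>2"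
        unfolding e_def by (simp only: norm_mult power_mult_distrib)
      moreover define N where "N = x\<^sup>2 + x * y + 2 * y\<^sup>2"
      moreover have N: "(cmod n)\<^sup>2 = of_int N"
        unfolding n_def N_def by (rule norm_Z_omega)
      ultimately have "real_of_int (2 ^ (i + j)) = real_of_int (N * 2 ^ (k + l))"
        by (simp add: norm_omega_powers)
      then have "2 ^ (i + j) = N * 2 ^ (k + l)"
        by (simp only: of_int_eq_iff)
      then have "N dvd 2 ^ (i + j)"
        by (metis dvd_triv_left)
      moreover have "coprime N (2 ^ (i + j))"
        using odd by (simp add: N_def)
      ultimately have "is_unit N"
        using coprime_absorb_left by blast
      then have "N \<le> 1"
        by simp
      then show False
        using large N by simp
    qed
    moreover have "a' \<noteq> 0"
      using False omega_neq_0 by (simp add: a'_def)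
    moreover have "d \<in> Z_omega"
      by (simp add: d_def)
    ultimately show ?thesis
      using solvable_of_divisors[OF nZ n0 _ a[folded a'_def] ad ae _ _ _ m(2,1)] g by simp
  qed
qed

section \<open>Divisibility by the primes above 2\<close>

lemma Z_omega_neq_0: "y \<noteq> 0 \<Longrightarrow> of_int x + of_int y * omega \<noteq> 0"
  by (simp add: omega_altdef complex_eq_iff)

lemma even_imp_omega_dvd:
  assumes "even x"
  obtains w where "w \<in> Z_omega" "of_int x + of_int y * omega = omega * w"
proof -
  obtain k where "x = 2 * k"
    using assms by blast
  \<comment> \<open>The cofactor comes from \<open>2 = omega * (1 - omega)\<close>.\<close>
  then have "of_int x + of_int y * omega = omega * (of_int (y + k) + of_int (- k) * omega)"
    by (simp add: omega_simps)
  then show ?thesis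
    using that Z_omegaI by blast
qed

lemma even_imp_one_minus_omega_dvd:
  assumes "even (x + y)"
  obtains w where "w \<in> Z_omega" "of_int x + of_int y * omega = (1 - omega) * w"
proof -
  obtain k where "x + y = 2 * k"
    using assms by blast
  then have x: "x = 2 * k - y"
    by simp
  \<comment> \<open>Regroup as \<open>2 * k - y * (1 - omega)\<close> and factor 2 as
    before.\<close>
  have "of_int x + of_int y * omega = (1 - omega) * (of_int (- y) + of_int k * omega)"
    unfolding x by (simp add: omega_simps)
  then show ?thesis
    using that Z_omegaI by blast
qed

section \<open>Explicit decompositions\<close>

lemma solvable_sqrt_minus_7: "solvable (2 * omega - 1)"
\<comment> \<open>With t = \<open>2 * omega - 1\<close> and t^2 = -7, the first two fractions add up
  to -t/2 = 7/(2t), which leaves 1/(2t).\<close>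
proof (rule solvableI[of "omega - 1" "omega" "4 * omega - 2"])
  have "2 * omega - 1 \<noteq> 0"
    using Z_omega_neq_0[of 2 "- 1"] by simp
  moreover show "omega - 1 \<noteq> 0" "omega \<noteq> 0" "4 * omega - 2 \<noteq> 0"
    using Z_omega_neq_0[of 1 "- 1"] Z_omega_neq_0[of 4 "- 2"] omega_neq_0 by auto
  ultimately show "4 / (2 * omega - 1) = 1 / (omega - 1) + 1 / omega + 1 / (4 * omega - 2)"
    by (simp add: add_frac_eq frac_eq_eq) (simp add: omega_simps)
qed auto

text \<open>For t = \<open>2 * omega + 3\<close> the first two denominators have sum t and product
  \<open>4 * omega\<close>, and t^2 = \<open>16 * omega + 1\<close>, so the remainder is -1/(4 omega
  t). The second t is minus the conjugate of the first, and \<open>1 - omega\<close> takes the place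
  of \<open>omega\<close>.\<close>

lemma solvable_norm_23: "solvable (2 * omega + 3)" "solvable (2 * omega - 5)"
proof -
  show "solvable (2 * omega + 3)"
  proof (rule solvableI[of "omega + 1" "omega + 2" "16 - 20 * omega"])
    have "2 * omega + 3 \<noteq> 0"
      using Z_omega_neq_0[of 2 3] by (simp add: add.commute)
    moreover show "omega + 1 \<noteq> 0" "omega + 2 \<noteq> 0" "16 - 20 * omega \<noteq> 0"
      using Z_omega_neq_0[of 1 1] Z_omega_neq_0[of 1 2] Z_omega_neq_0[of "- 20" 16]
      by (auto simp: add.commute)
    ultimately show "4 / (2 * omega + 3) = 1 / (omega + 1) + 1 / (omega + 2) + 1 / (16 - 20 * omega)"
      by (simp add: add_frac_eq frac_eq_eq) (simp add: omega_simps)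
  qed auto
  show "solvable (2 * omega - 5)"
  proof (rule solvableI[of "omega - 2" "omega - 3" "4 - 20 * omega"])
    have "2 * omega - 5 \<noteq> 0"
      using Z_omega_neq_0[of 2 "- 5"] by simp
    moreover show "omega - 2 \<noteq> 0" "omega - 3 \<noteq> 0" "4 - 20 * omega \<noteq> 0"
      using Z_omega_neq_0[of 1 "- 2"] Z_omega_neq_0[of 1 "- 3"] Z_omega_neq_0[of "- 20" 4] by auto
    ultimately show "4 / (2 * omega - 5) = 1 / (omega - 2) + 1 / (omega - 3) + 1 / (4 - 20 * omega)"
      by (simp add: add_frac_eq frac_eq_eq) (simp add: omega_simps)
  qed auto
qed

text \<open>These are the products of two primes above 2, the base cases for even
  \<open>n\<close>.\<close>

lemma solvable_norm_4: "solvable 2" "solvable (omega * omega)" "solvable ((1 - omega) * (1 - omega))"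
proof -
  show "solvable 2"
    by (rule solvableI[of 1 2 2]) auto
  have inv: "1 / omega = (1 - omega) / 2" "1 / (1 - omega) = omega / 2"
    by (subst frac_eq_eq; use omega_neq_0 in \<open>simp add: omega_simps\<close>)+
  show "solvable (omega * omega)"
  proof (rule solvableI[of "- 1" "- (1 - omega)" "- (1 - omega)"])
    have "4 / (omega * omega) = 4 * (1 / omega) * (1 / omega)"
      by simp
    also have "\<dots> = (1 - omega) * (1 - omega)"
      unfolding inv by simp
    also have "\<dots> = - 1 - omega / 2 - omega / 2"
      by (simp add: omega_simps)
    also have "\<dots> = 1 / - 1 + 1 / - (1 - omega) + 1 / - (1 - omega)"
      by (simp only: divide_minus_right inv) simp
    finally show "4 / (omega * omega) = 1 / - 1 + 1 / - (1 - omega) + 1 / - (1 - omega)" .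
  qed (use omega_neq_0 in auto)
  show "solvable ((1 - omega) * (1 - omega))"
  proof (rule solvableI[of "- 1" "- omega" "- omega"])
    have "4 / ((1 - omega) * (1 - omega)) = 4 * (1 / (1 - omega)) * (1 / (1 - omega))"
      by simp
    also have "\<dots> = omega * omega"
      unfolding inv by simp
    also have "\<dots> = - 1 - (1 - omega) / 2 - (1 - omega) / 2"
      by (simp add: omega_mult_omega field_simps)
    also have "\<dots> = 1 / - 1 + 1 / - omega + 1 / - omega"
      by (simp only: divide_minus_right inv) simp
    finally show "4 / ((1 - omega) * (1 - omega)) = 1 / - 1 + 1 / - omega + 1 / - omega" .
  qed (use omega_neq_0 in auto)
qed

section \<open>Odd \<open>n\<close>, by class modulo 4\<close>

lemma solvable_1_mod_4:
  assumes "k \<in> Z_omega" "n = 4 * k + 1" "n \<noteq> 0" "n \<noteq> 1"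
  shows "solvable n"
proof (rule solvableI[of "2 * k" "2 * k" "- (k * n)"])
  have "k \<noteq> 0"
    using assms by auto
  \<comment> \<open>Since \<open>n - 1 = 4 * k\<close>, already 4/n = 1/k - 1/(k n); halving 1/k
    yields three terms.\<close>
  then have "1 / (2 * k) + 1 / (2 * k) + 1 / - (k * n) = (n - 1) / (k * n)"
    using assms(3) by (simp add: field_simps)
  also have "\<dots> = 4 / n"
    using assms(2) \<open>k \<noteq> 0\<close> by simp
  finally show "4 / n = 1 / (2 * k) + 1 / (2 * k) + 1 / - (k * n)" ..
qed (use assms in auto)

lemma solvable_sqrt_minus_7_mod_4:
  fixes u v :: int
  defines "n \<equiv> of_int (4 * u + 1) + of_int (4 * v - 2) * omega"
  assumes large: "(cmod n)\<^sup>2 > 2"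
  shows "solvable n"
proof -
  define a where "a = of_int u + of_int v * omega"
  have n: "n = of_int (4 * u + 1) + of_int (4 * v - 2) * omega"
    by (simp add: n_def)
  have large': "(cmod (of_int (4 * u + 1) + of_int (4 * v - 2) * omega))\<^sup>2 > 2"
    using large n by simp
  have odd: "odd (4 * u + 1)" "even (4 * v - 2)"
    by auto
  \<comment> \<open>The offset -2 in the coefficient of \<open>omega\<close> is chosen for this
    identity.\<close>
  have n_a: "n = 4 * a - (2 * omega - 1)"
    by (simp add: n a_def algebra_simps)
  have res_7: "has_residue (2 * omega - 1) omega 4" "has_residue (2 * omega - 1) (of_int 7) 0"
    by (rule has_residueI[of "omega"], simp, simp add: omega_simps,
        rule has_residueI[of "1 - 2 * omega"], simp, simp add: omega_simps)
  consider "even u" | "even (u + v)" | "odd u" "even v"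
    by fastforce
  then show ?thesis
  proof cases
    case 1
    then obtain g where g: "g \<in> Z_omega" "a = omega * g"
      using even_imp_omega_dvd unfolding a_def by blast
    have "4 * (omega ^ 1 * (1 - omega) ^ 0 * g) = n + (2 * omega - 1)"
      by (simp add: n_a g)
    then show ?thesis
      unfolding n by (rule solvable_of_residue[OF odd large' solvable_sqrt_minus_7 res_7 g(1) _
            zero_less_numeral units_7(1)])
  next
    case 2
    then obtain g where g: "g \<in> Z_omega" "a = (1 - omega) * g"
      using even_imp_one_minus_omega_dvd unfolding a_def by blast
    have "4 * (omega ^ 0 * (1 - omega) ^ 1 * g) = n + (2 * omega - 1)"
      by (simp add: n_a g)
    then show ?thesis
      unfolding n by (rule solvable_of_residue[OF odd large' solvable_sqrt_minus_7 res_7 g(1) _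
            zero_less_numeral units_7(2)])
  next
    case 3
    then obtain u' v' where uv: "u = 2 * u' + 1" "v = 2 * v'"
      by (auto elim!: oddE evenE)
    show ?thesis
    \<comment> \<open>Now \<open>a = 1 + 2 * (u' + v' * omega)\<close>. Absorbing the constant into
      \<open>t\<close> gives \<open>2 * omega - 5\<close> with half-value
      \<open>u' + v' * omega\<close>, or \<open>2 * omega + 3\<close> with that value plus 1; the
      parity of \<open>u'\<close> tells which one \<open>omega\<close> divides.\<close>
    proof (cases "even u'")
      case True
      then obtain g where g: "g \<in> Z_omega" "of_int u' + of_int v' * omega = omega * g"
        using even_imp_omega_dvd by blast
      have "n = 8 * (of_int u' + of_int v' * omega) - (2 * omega - 5)"
        by (simp add: n uv algebra_simps)
      then have eq: "4 * (omega ^ 2 * (1 - omega) ^ 1 * g) = n + (2 * omega - 5)"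
        unfolding g(2) by (simp add: power2_eq_square omega_simps)
      have res: "has_residue (2 * omega - 5) omega 14" "has_residue (2 * omega - 5) (of_int 23) 0"
        by (rule has_residueI[of "omega + 2"], simp, simp add: omega_simps,
            rule has_residueI[of "- 2 * omega - 3"], simp, simp add: omega_simps)
      show ?thesis
        unfolding n by (rule solvable_of_residue[OF odd large' solvable_norm_23(2) res g(1)
              eq[unfolded n] zero_less_numeral units_23(2)])
    next
      case False
      then have "even (u' + 1)"
        by simp
      then obtain g where g: "g \<in> Z_omega" "of_int (u' + 1) + of_int v' * omega = omega * g"
        using even_imp_omega_dvd by blast
      have "n = 8 * (of_int (u' + 1) + of_int v' * omega) - (2 * omega + 3)"
        by (simp add: n uv algebra_simps)
      then have eq: "4 * (omega ^ 2 * (1 - omega) ^ 1 * g) = n + (2 * omega + 3)"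
        unfolding g(2) by (simp add: power2_eq_square omega_simps)
      have res: "has_residue (2 * omega + 3) omega 10" "has_residue (2 * omega + 3) (of_int 23) 0"
        by (rule has_residueI[of "omega - 2"], simp, simp add: omega_simps,
            rule has_residueI[of "5 - 2 * omega"], simp, simp add: omega_simps)
      show ?thesis
        unfolding n by (rule solvable_of_residue[OF odd large' solvable_norm_23(1) res g(1)
              eq[unfolded n] zero_less_numeral units_23(1)])
    qed
  qed
qed

lemma solvable_odd:
  fixes x y :: int
  defines "n \<equiv> of_int x + of_int y * omega"
  assumes odd: "odd x" "even y" and large: "(cmod n)\<^sup>2 > 2"
  shows "solvable n"
proof -
  have pos: "solvable (of_int (4 * u + 1) + of_int y * omega)"
    if "even y" "(cmod (of_int (4 * u + 1) + of_int y * omega))\<^sup>2 > 2" for u y :: int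
  proof (cases "4 dvd y")
    case True
    then obtain v where v: "y = 4 * v"
      by blast
    show ?thesis
    proof (rule solvable_1_mod_4[OF Z_omegaI[of u v]])
      show "of_int (4 * u + 1) + of_int y * omega \<noteq> 0"
        by (rule notI) (use that(2) in \<open>simp only: norm_zero, simp\<close>)
      show "of_int (4 * u + 1) + of_int y * omega \<noteq> 1"
        by (rule notI) (use that(2) in \<open>simp only: norm_one, simp\<close>)
    qed (simp add: v algebra_simps)
  next
    case False
    then have "\<exists>v. y = 4 * v - 2"
      using that(1) by presburger
    then obtain v where "y = 4 * v - 2" ..
    then show ?thesis
      using solvable_sqrt_minus_7_mod_4[of u v] that by simp
  qed
  \<comment> \<open>Up to sign an odd \<open>x\<close> is 1 modulo 4, which reduces to
    \<open>pos\<close>.\<close>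
  have "(\<exists>u. x = 4 * u + 1) \<or> (\<exists>u. - x = 4 * u + 1)"
    using odd(1) by presburger
  then consider u where "x = 4 * u + 1" | u where "- x = 4 * u + 1"
    by blast
  then show ?thesis
  proof cases
    case (1 u)
    then show ?thesis
      using pos[of y u] odd large by (simp add: n_def)
  next
    case (2 u)
    then have "- n = of_int (4 * u + 1) + of_int (- y) * omega"
      unfolding n_def 2[symmetric] by simp
    moreover have "(cmod (- n))\<^sup>2 > 2" "even (- y)"
      using large odd by simp_all
    ultimately have "solvable (- n)"
      using pos[of "- y" u] by metis
    then show ?thesis
      by (rule solvable_uminus)
  qed
qed

section \<open>Even \<open>n\<close> and the conclusion\<close>

lemma even_or_odd_cases:
  assumes "n \<in> Z_omega"
  obtains x y :: int where "n = of_int x + of_int y * omega" "odd x" "even y"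
  | w where "w \<in> Z_omega" "n = omega * w"
  | w where "w \<in> Z_omega" "n = (1 - omega) * w"
proof -
  obtain x y :: int where n: "n = of_int x + of_int y * omega"
    using assms by (auto simp: Z_omega_def)
  consider "even x" | "even (x + y)" | "odd x" "even y"
    by fastforce
  then show ?thesis
  proof cases
    case 1
    then obtain w where "w \<in> Z_omega" "n = omega * w"
      using even_imp_omega_dvd unfolding n by blast
    then show ?thesis
      by (rule that(2))
  next
    case 2
    then obtain w where "w \<in> Z_omega" "n = (1 - omega) * w"
      using even_imp_one_minus_omega_dvd unfolding n by blast
    then show ?thesis
      by (rule that(3))
  next
    case 3
    then show ?thesis
      by (rule that(1)[OF n])
  qed
qed

text \<open>An odd \<open>w\<close> is solvable itself and is scaled by \<open>q\<close>. If a prime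
  above 2 divides \<open>w\<close>, then \<open>q * w\<close> is a multiple of one of the elements
  of norm 4.\<close>

lemma solvable_even:
  assumes q: "q \<in> {omega, 1 - omega}" and "w \<in> Z_omega" and large: "(cmod (q * w))\<^sup>2 > 2"
  shows "solvable (q * w)"
proof -
  have norm: "(cmod (q * w))\<^sup>2 = 2 * (cmod w)\<^sup>2"
    using q norm_omega norm_one_minus_omega by (auto simp: norm_mult power_mult_distrib)
  have 2: "omega * (1 - omega) = 2"
    by (simp add: omega_simps)
  from \<open>w \<in> Z_omega\<close> show ?thesis
  proof (cases rule: even_or_odd_cases)
    case (1 x y)
    define N where "N = x\<^sup>2 + x * y + 2 * y\<^sup>2"
    have N: "(cmod w)\<^sup>2 = of_int N"
      unfolding 1(1) N_def by (rule norm_Z_omega)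
    then have "N > 1"
      using large norm by simp
    \<comment> \<open>Halving the norm only leaves \<open>N > 1\<close>; parity lifts this to the
      bound that \<open>solvable_odd\<close> requires.\<close>
    moreover have "odd N"
      using 1 by (simp add: N_def)
    ultimately have "N > 2"
      by presburger
    then have "solvable w"
      using 1 N solvable_odd[of x y] by simp
    then have "solvable (w * q)"
      by (rule solvable_mult) (use q omega_neq_0 in auto)
    then show ?thesis
      by (simp add: mult.commute)
  next
    case (2 w')
    have "w' \<noteq> 0"
      using large 2 by auto
    moreover have "solvable (q * omega)"
      using q solvable_norm_4 \<open>omega * (1 - omega) = 2\<close> by (auto simp: mult.commute)
    ultimately show ?thesis
      using solvable_mult[of "q * omega" w'] 2 by (simp add: mult.assoc)
  next
    case (3 w')
    have "w' \<noteq> 0"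
      using large 3 by auto
    moreover have "solvable (q * (1 - omega))"
      using q solvable_norm_4 \<open>omega * (1 - omega) = 2\<close> by auto
    ultimately show ?thesis
      using solvable_mult[of "q * (1 - omega)" w'] 3 by (simp add: mult.assoc)
  qed
qed

theorem theorem13:
  shows "\<forall>n \<in> Z_omega - E_minus7.
           \<exists>a \<in> Z_omega. \<exists>b \<in> Z_omega. \<exists>c \<in> Z_omega.
             a \<noteq> 0 \<and> b \<noteq> 0 \<and> c \<noteq> 0 \<and> 4 / n = 1 / a + 1 / b + 1 / c"
proof
  fix n
  assume "n \<in> Z_omega - E_minus7"
  then have n: "n \<in> Z_omega" and large: "(cmod n)\<^sup>2 > 2"
    by (auto simp: E_minus7_def)
  from n have "solvable n"
  proof (cases rule: even_or_odd_cases)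
    case (1 x y)
    then show ?thesis
      using solvable_odd large by simp
  next
    case (2 w)
    then show ?thesis
      using solvable_even[of omega w] large by simp
  next
    case (3 w)
    then show ?thesis
      using solvable_even[of "1 - omega" w] large by simp
  qed
  then show "\<exists>a \<in> Z_omega. \<exists>b \<in> Z_omega. \<exists>c \<in> Z_omega.
      a \<noteq> 0 \<and> b \<noteq> 0 \<and> c \<noteq> 0 \<and> 4 / n = 1 / a + 1 / b + 1 / c"
    unfolding solvable_def .
qed

end
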